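(* Let $Q$ be a nonzero commutative unital ring. For all positive integers $n$ and $M$, define $$p(n,M):=\frac{\left|\left\{\mathbf w\in\{1,2,\ldots,M\}^n\;\middle|\;P_{\mathbf w}^{(d_{\mathbf w})}\text{ and }R_{\mathbf w}^{(d_{\mathbf w})}\text{ are generated in degree }1\right\}\right|}{M^n}.$$ Then for every positive integer $n$, $\lim_{M\to+\infty}p(n,M)=1$.
   Context: For $\mathbf w=(w_1,\ldots,w_n)\in\mathbb Z_{\ge1}^n$: $d_{\mathbf w}=\operatorname{lcm}(w_1,\ldots,w_n)$; $P_{\mathbf w}=Q[x_1,\ldots,x_n]$ is the polynomial ring graded by $\deg x_i=w_i$; $R_{\mathbf w}:=Q[\{t^dx_i\mid i\in\{1,\ldots,n\},\ d\in\{0,\ldots,w_i\}\}]$ is the Rees ring, a subring of $Q[t,x_1,\ldots,x_n]$ graded by the degree in $t$ (so $x_1,\ldots,x_n$ have degree $0$). For a $\mathbb Z_{\ge0}$-graded ring $S$ and an integer $r\ge1$, the $r$th Veronese subring is $S^{(r)}:=\bigoplus_{m\ge0}S_{rm}$, where $S_{rm}$ is the $m$th graded component of $S^{(r)}$. A graded ring $S$ is generated in degree $1$ if $S=S_0\oplus\bigoplus_{m\ge1}S_1^m$, where $S_1^m$ is the additive subgroup generated by $m$-fold products of elements of $S_1$. *)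

theory Defs
  imports Complex_Main "HOL-Library.Poly_Mapping" "HOL-Library.FuncSet" "HOL.Hull"
begin

section \<open>Graded rings inside an ambient commutative ring\<close>

text \<open>
  A graded ring is represented by the family \<open>S\<close> of its homogeneous components, which are
  additive subgroups of an ambient commutative ring. Its elements are the values of the finite
  sums \<open>\<Sum>m. f m\<close> with \<open>f m \<in> S m\<close>.
\<close>

definition finsupp_families :: "(nat \<Rightarrow> 'b::comm_monoid_add set) \<Rightarrow> (nat \<Rightarrow> 'b) set" where
  "finsupp_families S = {f. (\<forall>m. f m \<in> S m) \<and> finite {m. f m \<noteq> 0}}"

definition graded_carrier :: "(nat \<Rightarrow> 'b::comm_monoid_add set) \<Rightarrow> 'b set" where
  "graded_carrier S = {(\<Sum>m. f m) | f. f \<in> finsupp_families S}"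

text \<open>Bijectivity says that every element of \<open>A\<close> has exactly one decomposition.\<close>

definition is_internal_direct_sum ::
    "'b::comm_monoid_add set \<Rightarrow> (nat \<Rightarrow> 'b set) \<Rightarrow> bool" where
  "is_internal_direct_sum A S \<longleftrightarrow> bij_betw (\<lambda>f. \<Sum>m. f m) (finsupp_families S) A"

definition veronese :: "nat \<Rightarrow> (nat \<Rightarrow> 'b set) \<Rightarrow> nat \<Rightarrow> 'b set" where
  "veronese r S = (\<lambda>m. S (r * m))"

definition additive_subgroup :: "'b::ab_group_add set \<Rightarrow> bool" where
  "additive_subgroup H \<longleftrightarrow> 0 \<in> H \<and> (\<forall>a\<in>H. \<forall>b\<in>H. a - b \<in> H)"

definition power_subgroup :: "'b::comm_ring_1 set \<Rightarrow> nat \<Rightarrow> 'b set" where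
  "power_subgroup A m = additive_subgroup hull {prod_list as | as. length as = m \<and> set as \<subseteq> A}"

definition generated_in_degree_one :: "(nat \<Rightarrow> 'b::comm_ring_1 set) \<Rightarrow> bool" where
  "generated_in_degree_one S \<longleftrightarrow>
     is_internal_direct_sum (graded_carrier S)
       (\<lambda>m. if m = 0 then S 0 else power_subgroup (S 1) m)"

section \<open>The polynomial ring and the Rees ring of a weight vector\<close>

text \<open>
  \<open>(nat \<Rightarrow>\<^sub>0 nat) \<Rightarrow>\<^sub>0 'a\<close> is the ring of polynomials over \<open>'a\<close>
  in indeterminates indexed by \<open>nat\<close>. Index \<open>0\<close> stands for \<open>t\<close>, and index \<open>i \<ge> 1\<close>
  for \<open>x\<^sub>i\<close>.
\<close>

type_synonym 'a mpoly = "(nat \<Rightarrow>\<^sub>0 nat) \<Rightarrow>\<^sub>0 'a"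

definition coeff_const :: "'a \<Rightarrow> 'a::comm_ring_1 mpoly" where
  "coeff_const c = Poly_Mapping.single 0 c"

definition indet :: "nat \<Rightarrow> 'a::comm_ring_1 mpoly" where
  "indet i = Poly_Mapping.single (Poly_Mapping.single i 1) 1"

abbreviation indet_t :: "'a::comm_ring_1 mpoly" where
  "indet_t \<equiv> indet 0"

definition subalgebra :: "'a::comm_ring_1 mpoly set \<Rightarrow> bool" where
  "subalgebra A \<longleftrightarrow> range coeff_const \<subseteq> A \<and>
     (\<forall>a\<in>A. \<forall>b\<in>A. a - b \<in> A \<and> a * b \<in> A)"

definition weighted_degree :: "(nat \<Rightarrow> nat) \<Rightarrow> (nat \<Rightarrow>\<^sub>0 nat) \<Rightarrow> nat" where
  "weighted_degree v \<mu> = (\<Sum>i\<in>Poly_Mapping.keys \<mu>. v i * Poly_Mapping.lookup \<mu> i)"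

definition homogeneous_component ::
    "(nat \<Rightarrow> nat) \<Rightarrow> 'a::comm_ring_1 mpoly set \<Rightarrow> nat \<Rightarrow> 'a mpoly set" where
  "homogeneous_component v A k =
     {p \<in> A. \<forall>\<mu>\<in>Poly_Mapping.keys p. weighted_degree v \<mu> = k}"

definition polynomial_ring :: "nat \<Rightarrow> 'a::comm_ring_1 mpoly set" where
  "polynomial_ring n = subalgebra hull {indet i | i. i \<in> {1..n}}"

definition rees_ring :: "nat \<Rightarrow> (nat \<Rightarrow> nat) \<Rightarrow> 'a::comm_ring_1 mpoly set" where
  "rees_ring n w = subalgebra hull {indet_t ^ d * indet i | i d. i \<in> {1..n} \<and> d \<in> {0..w i}}"

definition graded_P :: "nat \<Rightarrow> (nat \<Rightarrow> nat) \<Rightarrow> nat \<Rightarrow> 'a::comm_ring_1 mpoly set" where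
  "graded_P n w = homogeneous_component w (polynomial_ring n)"

definition graded_R :: "nat \<Rightarrow> (nat \<Rightarrow> nat) \<Rightarrow> nat \<Rightarrow> 'a::comm_ring_1 mpoly set" where
  "graded_R n w = homogeneous_component (\<lambda>i. if i = 0 then 1 else 0) (rees_ring n w)"

definition weight_lcm :: "nat \<Rightarrow> (nat \<Rightarrow> nat) \<Rightarrow> nat" where
  "weight_lcm n w = Lcm (w ` {1..n})"

definition good_weights :: "'a::comm_ring_1 itself \<Rightarrow> nat \<Rightarrow> nat \<Rightarrow> (nat \<Rightarrow> nat) set" where
  "good_weights Q n M = {w \<in> {1..n} \<rightarrow>\<^sub>E {1..M}.
     generated_in_degree_one
       (veronese (weight_lcm n w) (graded_P n w :: nat \<Rightarrow> 'a mpoly set)) \<and>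
     generated_in_degree_one
       (veronese (weight_lcm n w) (graded_R n w :: nat \<Rightarrow> 'a mpoly set))}"

definition proportion :: "'a::comm_ring_1 itself \<Rightarrow> nat \<Rightarrow> nat \<Rightarrow> real" where
  "proportion Q n M = real (card (good_weights Q n M)) / real M ^ n"

end

theory Submission
  imports Defs
begin

text \<open>
  Both rings are spanned by monomials, so generation in degree \<open>1\<close> amounts to splitting exponent
  vectors: whenever \<open>\<Sum>i. a\<^sub>i * w\<^sub>i \<ge> 2 * d\<close> for \<open>d = lcm w\<close>, one needs \<open>b \<le> a\<close> with
  \<open>\<Sum>i. b\<^sub>i * w\<^sub>i = d\<close> exactly. If \<open>n \<le> 2\<close>, then some single \<open>a\<^sub>i * w\<^sub>i\<close> is at least \<open>d\<close>.
  Otherwise it suffices that \<open>d \<ge> 2 * n * M^2\<close> where \<open>M\<close> bounds the weights: if no single term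
  reaches \<open>d\<close>, two of them are at least \<open>2 * M^2\<close>, and these two absorb any multiple of the gcd
  of their weights in a long interval, while the other coordinates, taken in multiples of that
  gcd, bring the remaining target into this interval.

  For \<open>n \<ge> 3\<close>, up to a proportion \<open>6 / G\<close> of exceptions, the weights \<open>w\<^sub>1, w\<^sub>2, w\<^sub>3\<close> exceed
  \<open>M / G\<close> and have pairwise gcds at most \<open>G\<close>, so that \<open>lcm w \<ge> M^3 / G^6\<close>, which exceeds
  \<open>2 * n * M^2\<close> for large \<open>M\<close>.
\<close>

section \<open>Splitting off a subvector of given weight\<close>

text \<open>As the gcd divides \<open>T\<close>, a whole residue class mod \<open>v\<close> of
  values \<open>x\<close> makes \<open>T - x * u\<close> divisible by \<open>v\<close>. The bounds
  \<open>x \<le> a\<close> and \<open>0 \<le> y \<le> b\<close> leave room for \<open>v\<close>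
  consecutive values of \<open>x\<close>, hence for one from this class.\<close>

lemma dvd_two_var_rep_nat:
  fixes u v T a b :: nat
  assumes pos: "u > 0" "v > 0" and dvd: "gcd u v dvd T"
    and T: "u * v \<le> T" "T + u * v \<le> a * u + b * v"
    and big: "u * v \<le> a * u" "u * v \<le> b * v"
  shows "\<exists>x y. x \<le> a \<and> y \<le> b \<and> x * u + y * v = T"
proof -
  obtain k where k: "T = gcd u v * k" using dvd by blast
  obtain p q where pq: "u * p = v * q + gcd u v" using bezout_nat pos(1) by blast
  \<comment> \<open>The ceiling of \<open>(T - b * v) / u\<close>, truncated at 0: the least
    \<open>x\<close> whose remainder \<open>T - x * u\<close> is at most
    \<open>b * v\<close>.\<close>
  define x0 where "x0 = (T - b * v + u - 1) div u"
  \<comment> \<open>The least number from \<open>x0\<close> on that is congruent to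
    \<open>p * k\<close> mod \<open>v\<close>; this class works because
    \<open>u * (p * k) = v * (q * k) + T\<close>.\<close>
  define x where "x = x0 + nat ((int (p * k) - int x0) mod int v)"
  have x_lt: "x < x0 + v"
    using pos(2) by (simp add: x_def nat_less_iff)
  have "int v dvd int x - int (p * k)"
  proof -
    have "int x - int (p * k) = (int (p * k) - int x0) mod int v - (int (p * k) - int x0)"
      using pos(2) by (simp add: x_def)
    then show ?thesis
      by (metis dvd_minus_mod dvd_diff_commute)
  qed
  then have "int v dvd (int x - int (p * k)) * int u + int v * int (q * k)"
    by simp
  moreover have "(int x - int (p * k)) * int u + int v * int (q * k) = int x * int u - int T"
  proof -
    have "int (u * p) * int k = int (v * q + gcd u v) * int k" by (simp only: pq)
    then show ?thesis unfolding k by (simp add: algebra_simps)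
  qed
  ultimately have cong: "int v dvd int x * int u - int T" by simp
  have low: "T - b * v \<le> x0 * u"
  proof -
    have "T - b * v + u - 1 < x0 * u + u"
      unfolding x0_def using pos(1) div_mult_mod_eq[of "T - b * v + u - 1" u]
        mod_less_divisor[of u "T - b * v + u - 1"] by linarith
    then show ?thesis using pos(1) by linarith
  qed
  have up: "x0 * u \<le> T - b * v + u - 1"
    unfolding x0_def by simp
  have "(x + 1) * u \<le> (x0 + v) * u" using x_lt by (intro mult_right_mono) auto
  then have xu: "x * u + u \<le> x0 * u + u * v" by (simp add: algebra_simps)
  \<comment> \<open>The estimates combine to \<open>x * u < (T - b * v) + u * v\<close>. If the
    difference is truncated to 0, use \<open>u * v \<le> T\<close> and
    \<open>u * v \<le> a * u\<close>; otherwise use \<open>u * v \<le> b * v\<close> and the upper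
    bound on \<open>T\<close>.\<close>
  have xT: "x * u \<le> T" and xa: "x * u \<le> a * u"
    using xu up T big pos by linarith+
  have "x0 * u \<le> x * u" by (simp add: x_def)
  then have Tb: "T - x * u \<le> b * v" using low xT by linarith
  have "v dvd T - x * u"
  proof -
    have "int v dvd int (T - x * u)"
      using cong xT by (simp add: of_nat_diff dvd_diff_commute)
    then show ?thesis by simp
  qed
  then obtain y where y: "T - x * u = y * v" by (metis dvdE mult.commute)
  have "x \<le> a" using xa pos by simp
  moreover have "y \<le> b" using Tb pos unfolding y by simp
  moreover have "x * u + y * v = T" using y xT by linarith
  ultimately show ?thesis by blast
qed

text \<open>Among the admissible \<open>c\<close> of weight at least \<open>X\<close>, take one of
  least weight. If it overshot by more than \<open>g * M\<close>, lowering a nonzero coordinate by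
  \<open>g\<close> would lose at most \<open>g * M\<close> and stay admissible, against
  minimality.\<close>

lemma subvector_multiples_near_target:
  fixes w a :: "'i \<Rightarrow> nat"
  assumes fin: "finite J" and w: "\<And>i. i \<in> J \<Longrightarrow> 0 < w i \<and> w i \<le> M"
    and g: "g > 0" and X: "X \<le> (\<Sum>i\<in>J. g * (a i div g) * w i)"
  shows "\<exists>c. (\<forall>i\<in>J. c i \<le> a i \<and> g dvd c i) \<and> X \<le> (\<Sum>i\<in>J. c i * w i)
           \<and> (\<Sum>i\<in>J. c i * w i) \<le> X + g * M"
proof -
  define ok where "ok c \<longleftrightarrow> (\<forall>i\<in>J. c i \<le> a i \<and> g dvd c i) \<and> X \<le> (\<Sum>i\<in>J. c i * w i)" for c
  have "ok (\<lambda>i. g * (a i div g))"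
    using X by (auto simp: ok_def)
  then obtain c where c: "ok c"
    and minim: "\<And>c'. ok c' \<Longrightarrow> (\<Sum>i\<in>J. c i * w i) \<le> (\<Sum>i\<in>J. c' i * w i)"
    using ex_has_least_nat[of ok _ "\<lambda>c. \<Sum>i\<in>J. c i * w i"] by blast
  have "(\<Sum>i\<in>J. c i * w i) \<le> X + g * M"
  proof (rule ccontr)
    assume far: "\<not> ?thesis"
    then have "(\<Sum>i\<in>J. c i * w i) \<noteq> 0" by linarith
    then have "\<exists>x\<in>J. c x * w x \<noteq> 0"
      by (rule contrapos_np) (intro sum.neutral, blast)
    then obtain x where x: "x \<in> J" "c x \<noteq> 0" by auto
    define c' where "c' = c(x := c x - g)"
    have "g dvd c x" using c x by (simp add: ok_def)
    then have gx: "g \<le> c x" using x by (simp add: dvd_imp_le)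
    have rest: "(\<Sum>i\<in>J - {x}. c' i * w i) = (\<Sum>i\<in>J - {x}. c i * w i)"
      by (intro sum.cong) (auto simp: c'_def)
    have "(\<Sum>i\<in>J. c i * w i) = c x * w x + (\<Sum>i\<in>J - {x}. c i * w i)"
      using fin x by (simp add: sum.remove)
    moreover have "(\<Sum>i\<in>J. c' i * w i) = c' x * w x + (\<Sum>i\<in>J - {x}. c' i * w i)"
      using fin x by (simp add: sum.remove)
    moreover have "c x * w x = c' x * w x + g * w x"
      using gx by (simp add: c'_def flip: distrib_right)
    ultimately have diff: "(\<Sum>i\<in>J. c i * w i) = (\<Sum>i\<in>J. c' i * w i) + g * w x"
      using rest by simp
    have "g * w x \<le> g * M" using w x by simp
    then have "X \<le> (\<Sum>i\<in>J. c' i * w i)" using diff far by linarith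
    moreover have "\<forall>i\<in>J. c' i \<le> a i \<and> g dvd c' i"
      using c \<open>g dvd c x\<close> by (auto simp: ok_def c'_def intro: dvd_diff_nat le_trans[OF diff_le_self])
    ultimately have "ok c'" by (simp add: ok_def)
    from minim[OF this] diff have "g * w x = 0" by linarith
    then show False using g w[OF x(1)] by simp
  qed
  then show ?thesis using c by (auto simp: ok_def)
qed

lemma ex_maximizer_finite:
  fixes f :: "'i \<Rightarrow> 'b::linorder"
  assumes "finite I" "I \<noteq> {}"
  shows "\<exists>i\<in>I. \<forall>k\<in>I. f k \<le> f i"
proof -
  have "Max (f ` I) \<in> f ` I" using assms by simp
  then obtain i where "Max (f ` I) = f i" "i \<in> I" by (rule imageE)
  then show ?thesis using assms by (metis Max_ge finite_imageI imageI)
qed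

text \<open>The combinatorial core: splitting off weight exactly \<open>d\<close>. The two largest
  terms \<open>i\<close>, \<open>j\<close> provide the fine adjustment through
  \<open>dvd_two_var_rep_nat\<close>, and the remaining coordinates \<open>J\<close> the coarse
  approximation.\<close>

lemma ex_subvector_of_weight:
  fixes w a :: "'i \<Rightarrow> nat"
  assumes fin: "finite I" and w: "\<And>i. i \<in> I \<Longrightarrow> 0 < w i \<and> w i \<le> M"
    and dvd: "\<And>i. i \<in> I \<Longrightarrow> w i dvd d" and d: "d > 0"
    and large: "card I \<le> 2 \<or> 2 * card I * M\<^sup>2 \<le> d"
    and S: "2 * d \<le> (\<Sum>i\<in>I. a i * w i)"
  shows "\<exists>b. (\<forall>i\<in>I. b i \<le> a i) \<and> (\<Sum>i\<in>I. b i * w i) = d"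
proof (cases "\<exists>i\<in>I. d \<le> a i * w i")
  case True
  then obtain i where i: "i \<in> I" "d \<le> a i * w i" by blast
  have "d div w i \<le> a i"
    using div_le_mono[OF i(2), of "w i"] w[OF i(1)] by simp
  moreover have "(\<Sum>j\<in>I. (if j = i then d div w i else 0) * w j) = d"
  proof -
    have "(\<Sum>j\<in>I. (if j = i then d div w i else 0) * w j) = (\<Sum>j\<in>I. if j = i then d else 0)"
      using dvd[OF i(1)] by (intro sum.cong) auto
    then show ?thesis using fin i by simp
  qed
  ultimately show ?thesis
    by (intro exI[of _ "\<lambda>j. if j = i then d div w i else 0"]) auto
next
  case False
  then have small: "a i * w i < d" if "i \<in> I" for i using that by force
  have "I \<noteq> {}" using S d by auto
  then obtain i where i: "i \<in> I" and imax: "\<And>k. k \<in> I \<Longrightarrow> a k * w k \<le> a i * w i"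
    using ex_maximizer_finite[OF fin, of "\<lambda>k. a k * w k"] by blast
  have sum_i: "(\<Sum>k\<in>I. a k * w k) = a i * w i + (\<Sum>k\<in>I - {i}. a k * w k)"
    using fin i by (simp add: sum.remove)
  \<comment> \<open>The total is at least \<open>2 * d\<close> and the largest term is below
    \<open>d\<close>.\<close>
  then have rest: "d < (\<Sum>k\<in>I - {i}. a k * w k)" using S small[OF i] by linarith
  then have "I - {i} \<noteq> {}" by (metis not_less_zero sum.empty)
  then obtain j where j: "j \<in> I - {i}" and jmax: "\<And>k. k \<in> I - {i} \<Longrightarrow> a k * w k \<le> a j * w j"
    using ex_maximizer_finite[of "I - {i}" "\<lambda>k. a k * w k"] fin by blast
  \<comment> \<open>Pigeonhole: the second largest term is at least the average of the terms other
    than \<open>i\<close>.\<close>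
  have "(\<Sum>k\<in>I - {i}. a k * w k) \<le> card (I - {i}) * (a j * w j)"
    using sum_bounded_above[of "I - {i}" "\<lambda>k. a k * w k" "a j * w j"] jmax by simp
  then have jbig: "d < (card I - 1) * (a j * w j)" using rest i fin by simp
  have card: "2 * card I * M\<^sup>2 \<le> d" and card_gt: "card I > 2"
  proof -
    \<comment> \<open>With at most two coordinates the average is the \<open>j\<close> term itself,
      which would then exceed \<open>d\<close>.\<close>
    have "\<not> card I \<le> 2"
    proof
      assume "card I \<le> 2"
      then have "(card I - 1) * (a j * w j) \<le> 1 * (a j * w j)" by (intro mult_right_mono) auto
      then have "d < a j * w j" using jbig by linarith
      then show False using small[of j] j by simp
    qed
    then show "2 * card I * M\<^sup>2 \<le> d" "card I > 2" using large by auto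
  qed
  have "card I * (2 * M\<^sup>2) < card I * (a j * w j)"
  proof -
    have "(card I - 1) * (a j * w j) \<le> card I * (a j * w j)" by (intro mult_right_mono) auto
    moreover have "card I * (2 * M\<^sup>2) = 2 * card I * M\<^sup>2" by simp
    ultimately show ?thesis using jbig card by linarith
  qed
  then have aj: "2 * M\<^sup>2 \<le> a j * w j" by simp
  have ai: "2 * M\<^sup>2 \<le> a i * w i" using aj imax[of j] j by simp
  define J where "J = I - {i} - {j}"
  define A where "A = a i * w i + a j * w j"
  define g where "g = gcd (w i) (w j)"
  have wi: "0 < w i" "w i \<le> M" and wj: "0 < w j" "w j \<le> M" using w i j by auto
  have g_pos: "g > 0" using wi by (simp add: g_def)
  have "g \<le> M" using gcd_le1_nat[of "w i" "w j"] wi unfolding g_def by linarith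
  then have gM: "g * M \<le> M\<^sup>2" by (simp add: power2_eq_square)
  have L: "w i * w j \<le> M\<^sup>2" using wi wj by (simp add: power2_eq_square mult_mono)
  have sumJ: "(\<Sum>k\<in>I. f k) = f i + f j + (\<Sum>k\<in>J. f k)" for f :: "'i \<Rightarrow> nat"
    using fin i j by (simp add: sum.remove J_def)
  have finJ: "finite J" using fin by (simp add: J_def)
  \<comment> \<open>Rounding \<open>a k\<close> down to a multiple of \<open>g\<close> discards
    fewer than \<open>g \<le> M\<close> copies of \<open>w k \<le> M\<close>, so at most
    \<open>M\<^sup>2\<close> per coordinate.\<close>
  have "(\<Sum>k\<in>J. a k * w k) \<le> (\<Sum>k\<in>J. g * (a k div g) * w k + M\<^sup>2)"
  proof (intro sum_mono)
    fix k assume "k \<in> J"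
    then have wk: "w k \<le> M" using w by (simp add: J_def)
    have "a k * w k = g * (a k div g) * w k + (a k mod g) * w k"
      unfolding distrib_right[symmetric] by simp
    moreover have "(a k mod g) * w k \<le> M * M"
      using wk \<open>g \<le> M\<close> g_pos by (intro mult_mono) (auto intro: order_trans[OF mod_le_divisor])
    ultimately show "a k * w k \<le> g * (a k div g) * w k + M\<^sup>2" by (simp add: power2_eq_square)
  qed
  also have "\<dots> = (\<Sum>k\<in>J. g * (a k div g) * w k) + card J * M\<^sup>2"
    by (simp add: sum.distrib)
  finally have full: "(\<Sum>k\<in>J. a k * w k) \<le> (\<Sum>k\<in>J. g * (a k div g) * w k) + card J * M\<^sup>2" .
  have cardJ: "card I = card J + 2" using fin i j card_gt by (simp add: J_def)
  have dbig: "2 * (card J * M\<^sup>2) + 4 * M\<^sup>2 \<le> d"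
    using card unfolding cardJ by (simp add: algebra_simps)
  have SJ: "2 * d \<le> A + (\<Sum>k\<in>J. a k * w k)" using S sumJ[of "\<lambda>k. a k * w k"] by (simp add: A_def)
  \<comment> \<open>The part \<open>C\<close> taken from \<open>J\<close> must leave
    \<open>d - C\<close> between \<open>w i * w j\<close> and \<open>A - w i * w j\<close>, where
    two variables suffice. This is the lower end for \<open>C\<close>; \<open>dbig\<close> pays for
    the rounding losses.\<close>
  have "d + w i * w j - A \<le> (\<Sum>k\<in>J. g * (a k div g) * w k)"
    using full dbig SJ L by linarith
  from subvector_multiples_near_target[OF finJ _ g_pos this, of M] w
  obtain c where c: "\<forall>k\<in>J. c k \<le> a k \<and> g dvd c k"
    and c_ge: "d + w i * w j - A \<le> (\<Sum>k\<in>J. c k * w k)"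
    and c_le: "(\<Sum>k\<in>J. c k * w k) \<le> d + w i * w j - A + g * M"
    by (auto simp: J_def)
  define C where "C = (\<Sum>k\<in>J. c k * w k)"
  \<comment> \<open>The upper end for \<open>C\<close>: the slack
    \<open>A \<ge> 4 * M\<^sup>2\<close> absorbs the overshoot \<open>g * M\<close> and twice
    \<open>w i * w j\<close>. If the truncated target is 0, then \<open>C \<le> M\<^sup>2\<close>
    and \<open>dbig\<close> suffices.\<close>
  have Cd: "C + w i * w j \<le> d"
    using c_le gM L ai aj dbig unfolding A_def C_def[symmetric] by linarith
  have "g dvd d" using dvd[OF i] by (simp add: g_def dvd_trans[OF gcd_dvd1])
  moreover have "g dvd C" using c by (auto simp: C_def intro!: dvd_sum)
  ultimately have "gcd (w i) (w j) dvd d - C" by (simp add: g_def)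
  moreover have "w i * w j \<le> d - C" using Cd by linarith
  moreover have "d - C + w i * w j \<le> a i * w i + a j * w j"
    using c_ge Cd unfolding A_def C_def[symmetric] by linarith
  moreover have "w i * w j \<le> a i * w i" "w i * w j \<le> a j * w j"
    using ai aj L by linarith+
  ultimately have "\<exists>x y. x \<le> a i \<and> y \<le> a j \<and> x * w i + y * w j = d - C"
    using wi wj by (intro dvd_two_var_rep_nat)
  then obtain x y where xy: "x \<le> a i" "y \<le> a j" "x * w i + y * w j = d - C" by blast
  define b where "b = c(i := x, j := y)"
  have bJ: "(\<Sum>k\<in>J. b k * w k) = C"
    unfolding C_def by (intro sum.cong) (auto simp: b_def J_def)
  have "(\<Sum>k\<in>I. b k * w k) = d"
    unfolding sumJ bJ using xy Cd j by (auto simp: b_def)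
  moreover have "\<forall>k\<in>I. b k \<le> a k" using c xy by (auto simp: b_def J_def)
  ultimately show ?thesis by blast
qed

section \<open>Generation in degree one for monomial subalgebras\<close>

text \<open>The span of the monomials with exponents in \<open>T\<close>; for
  \<open>add_closed T\<close> this is the monoid algebra of \<open>T\<close>.\<close>

definition supported_on :: "(nat \<Rightarrow>\<^sub>0 nat) set \<Rightarrow> 'a::comm_ring_1 mpoly set" where
  "supported_on T = {p. Poly_Mapping.keys p \<subseteq> T}"

definition add_closed :: "'b::monoid_add set \<Rightarrow> bool" where
  "add_closed T \<longleftrightarrow> 0 \<in> T \<and> (\<forall>x\<in>T. \<forall>y\<in>T. x + y \<in> T)"

lemma keys_diff_subset:
  fixes p q :: "'b \<Rightarrow>\<^sub>0 'c::ab_group_add"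
  shows "Poly_Mapping.keys (p - q) \<subseteq> Poly_Mapping.keys p \<union> Poly_Mapping.keys q"
  by (auto simp: in_keys_iff lookup_minus)

lemma sum_single_keys:
  fixes p :: "'b \<Rightarrow>\<^sub>0 'c::comm_monoid_add"
  shows "(\<Sum>\<mu>\<in>Poly_Mapping.keys p. Poly_Mapping.single \<mu> (Poly_Mapping.lookup p \<mu>)) = p"
proof (rule poly_mapping_eqI)
  fix \<nu>
  have "(\<Sum>\<mu>\<in>Poly_Mapping.keys p. Poly_Mapping.lookup p \<mu> when \<mu> = \<nu>) = Poly_Mapping.lookup p \<nu>"
    by (simp add: when_def in_keys_iff)
  then show "Poly_Mapping.lookup (\<Sum>\<mu>\<in>Poly_Mapping.keys p. Poly_Mapping.single \<mu> (Poly_Mapping.lookup p \<mu>)) \<nu>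
      = Poly_Mapping.lookup p \<nu>"
    by (simp add: lookup_sum lookup_single)
qed

lemma keys_mult_subset:
  fixes p q :: "'a::comm_ring_1 mpoly"
  assumes "\<mu> \<in> Poly_Mapping.keys (p * q)"
  obtains \<alpha> \<beta> where "\<alpha> \<in> Poly_Mapping.keys p" "\<beta> \<in> Poly_Mapping.keys q" "\<mu> = \<alpha> + \<beta>"
  using assms keys_mult[of p q] by blast

lemma subalgebra_supported_on:
  assumes "add_closed T"
  shows "subalgebra (supported_on T :: 'a::comm_ring_1 mpoly set)"
  unfolding subalgebra_def
proof (intro conjI ballI)
  show "range coeff_const \<subseteq> (supported_on T :: 'a mpoly set)"
    using assms by (auto simp: supported_on_def coeff_const_def add_closed_def split: if_splits)
  fix p q :: "'a mpoly" assume pq: "p \<in> supported_on T" "q \<in> supported_on T"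
  then show "p - q \<in> supported_on T"
    using keys_diff_subset[of p q] by (auto simp: supported_on_def)
  show "p * q \<in> supported_on T"
    using pq assms by (auto simp: supported_on_def add_closed_def elim!: keys_mult_subset)
qed

lemma additive_subgroup_subalgebra: "subalgebra A \<Longrightarrow> additive_subgroup A"
proof -
  assume A: "subalgebra A"
  then have "coeff_const 0 \<in> A" by (auto simp: subalgebra_def)
  then show ?thesis using A by (auto simp: subalgebra_def additive_subgroup_def coeff_const_def)
qed

lemma additive_subgroup_sum:
  assumes H: "additive_subgroup H" and f: "\<And>x. x \<in> X \<Longrightarrow> f x \<in> H"
  shows "sum f X \<in> H"
  using f
proof (induction X rule: infinite_finite_induct)
  case (insert x X)
  have "0 - sum f X \<in> H" using insert H unfolding additive_subgroup_def by blast
  then have "f x - (0 - sum f X) \<in> H" using insert H unfolding additive_subgroup_def by blast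
  then show ?case using insert by simp
qed (use H in \<open>auto simp: additive_subgroup_def\<close>)

lemma mem_additive_subgroup_if_monomials:
  fixes p :: "'a::comm_ring_1 mpoly"
  assumes "additive_subgroup H"
    and "\<And>\<mu>. \<mu> \<in> Poly_Mapping.keys p \<Longrightarrow> Poly_Mapping.single \<mu> (Poly_Mapping.lookup p \<mu>) \<in> H"
  shows "p \<in> H"
  by (subst sum_single_keys[symmetric]) (intro additive_subgroup_sum assms)

lemma additive_subgroup_hull: "additive_subgroup (additive_subgroup hull X)"
  by (rule hull_in) (auto simp: additive_subgroup_def)

lemma subalgebra_hull: "subalgebra (subalgebra hull X)"
  by (rule hull_in) (auto simp: subalgebra_def)

text \<open>Peeling off one generator at a time, with \<open>f\<close> as termination measure,
  writes each monomial with exponent in \<open>T\<close> as a product of generators; constants and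
  sums then give all of \<open>supported_on T\<close>.\<close>

lemma subalgebra_hull_eq_supported_on:
  fixes G :: "'a::comm_ring_1 mpoly set"
  assumes T: "add_closed T" and G: "G \<subseteq> supported_on T"
    and reduce: "\<And>\<mu>. \<mu> \<in> T \<Longrightarrow> \<mu> \<noteq> 0 \<Longrightarrow>
      \<exists>\<gamma> \<mu>'. \<mu> = \<gamma> + \<mu>' \<and> Poly_Mapping.single \<gamma> 1 \<in> G \<and> \<mu>' \<in> T \<and> (f \<mu>' :: nat) < f \<mu>"
  shows "subalgebra hull G = supported_on T"
proof
  show "subalgebra hull G \<subseteq> supported_on T"
    by (intro hull_minimal G subalgebra_supported_on T)
  have sub: "subalgebra (subalgebra hull G)" by (rule subalgebra_hull)
  have one: "Poly_Mapping.single \<mu> 1 \<in> subalgebra hull G" if "\<mu> \<in> T" for \<mu>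
    using that
  proof (induction "f \<mu>" arbitrary: \<mu> rule: less_induct)
    case less
    show ?case
    proof (cases "\<mu> = 0")
      case True
      have "coeff_const 1 \<in> subalgebra hull G" using sub by (auto simp: subalgebra_def)
      then show ?thesis using True by (simp add: coeff_const_def)
    next
      case False
      then obtain \<gamma> \<mu>' where \<gamma>: "\<mu> = \<gamma> + \<mu>'" "Poly_Mapping.single \<gamma> 1 \<in> G" "\<mu>' \<in> T" "f \<mu>' < f \<mu>"
        using reduce less.prems by blast
      have "Poly_Mapping.single \<gamma> 1 * Poly_Mapping.single \<mu>' 1 \<in> subalgebra hull G"
        using sub \<gamma> less.hyps hull_inc[of _ G subalgebra] by (auto simp: subalgebra_def)
      then show ?thesis using \<gamma> by (simp add: mult_single)
    qed
  qed
  show "supported_on T \<subseteq> subalgebra hull G"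
  proof
    fix p :: "'a mpoly" assume p: "p \<in> supported_on T"
    show "p \<in> subalgebra hull G"
    proof (rule mem_additive_subgroup_if_monomials[OF additive_subgroup_subalgebra[OF sub]])
      fix \<mu> assume "\<mu> \<in> Poly_Mapping.keys p"
      then have "Poly_Mapping.single \<mu> 1 \<in> subalgebra hull G" using p one by (auto simp: supported_on_def)
      then have "coeff_const (Poly_Mapping.lookup p \<mu>) * Poly_Mapping.single \<mu> 1 \<in> subalgebra hull G"
        using sub by (auto simp: subalgebra_def)
      then show "Poly_Mapping.single \<mu> (Poly_Mapping.lookup p \<mu>) \<in> subalgebra hull G"
        by (simp add: coeff_const_def mult_single)
    qed
  qed
qed

section \<open>Weighted degrees and homogeneous components\<close>

lemma weighted_degree_eq_sum:
  assumes "finite I" "Poly_Mapping.keys \<mu> \<subseteq> I"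
  shows "weighted_degree v \<mu> = (\<Sum>i\<in>I. v i * Poly_Mapping.lookup \<mu> i)"
  unfolding weighted_degree_def using assms
  by (intro sum.mono_neutral_left) (auto simp: in_keys_iff)

lemma weighted_degree_add: "weighted_degree v (\<mu> + \<nu>) = weighted_degree v \<mu> + weighted_degree v \<nu>"
proof -
  let ?I = "Poly_Mapping.keys \<mu> \<union> Poly_Mapping.keys \<nu>"
  have "weighted_degree v (\<mu> + \<nu>) = (\<Sum>i\<in>?I. v i * Poly_Mapping.lookup (\<mu> + \<nu>) i)"
    by (rule weighted_degree_eq_sum) (auto simp: keys_add)
  also have "\<dots> = weighted_degree v \<mu> + weighted_degree v \<nu>"
    by (simp add: weighted_degree_eq_sum[of ?I] lookup_add distrib_left sum.distrib)
  finally show ?thesis .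
qed

lemma additive_subgroup_homogeneous_component:
  "additive_subgroup A \<Longrightarrow> additive_subgroup (homogeneous_component v A k)"
  using keys_diff_subset by (fastforce simp: additive_subgroup_def homogeneous_component_def)

lemma homogeneous_component_mult:
  assumes "subalgebra A" "p \<in> homogeneous_component v A k" "q \<in> homogeneous_component v A l"
  shows "p * q \<in> homogeneous_component v A (k + l)"
  using assms unfolding homogeneous_component_def
  by (auto simp: subalgebra_def weighted_degree_add elim!: keys_mult_subset)

lemma prod_list_homogeneous_component:
  assumes "subalgebra A" "set as \<subseteq> homogeneous_component v A k"
  shows "prod_list as \<in> homogeneous_component v A (k * length as)"
  using assms(2)
proof (induction as)
  case Nil
  have "coeff_const 1 \<in> A" using assms(1) by (auto simp: subalgebra_def)
  then show ?case by (simp add: homogeneous_component_def coeff_const_def weighted_degree_def)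
next
  case (Cons p as)
  then show ?case using homogeneous_component_mult[OF assms(1), of p v k] by simp
qed

text \<open>A monomial has only one weighted degree, and \<open>m \<mapsto> d * m\<close> is
  injective, so each coefficient of the sum comes from a single component and determines it.
  Surjectivity is the definition of the carrier.\<close>

lemma internal_direct_sum_veronese:
  assumes "d > 0"
  shows "is_internal_direct_sum (graded_carrier (veronese d (homogeneous_component v A)))
           (veronese d (homogeneous_component v A))"
proof -
  let ?S = "veronese d (homogeneous_component v A)"
  have lookup: "Poly_Mapping.lookup (Sum_any f) \<mu> = Poly_Mapping.lookup (f m) \<mu>"
    if f: "f \<in> finsupp_families ?S" and \<mu>: "weighted_degree v \<mu> = d * m" for f \<mu> m
  proof -
    have fin: "finite {k. f k \<noteq> 0}" using f by (simp add: finsupp_families_def)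
    have zero: "Poly_Mapping.lookup (f k) \<mu> = 0" if "k \<noteq> m" for k
    proof (rule ccontr)
      assume "Poly_Mapping.lookup (f k) \<mu> \<noteq> 0"
      then have "\<mu> \<in> Poly_Mapping.keys (f k)" by (simp add: in_keys_iff)
      moreover have "f k \<in> ?S k" using f by (simp add: finsupp_families_def)
      ultimately have "weighted_degree v \<mu> = d * k" by (simp add: veronese_def homogeneous_component_def)
      then show False using \<mu> that assms by simp
    qed
    have "Poly_Mapping.lookup (Sum_any f) \<mu> = (\<Sum>k\<in>{k. f k \<noteq> 0}. Poly_Mapping.lookup (f k) \<mu>)"
      by (simp add: Sum_any.expand_set lookup_sum)
    also have "\<dots> = (\<Sum>k\<in>insert m {k. f k \<noteq> 0}. Poly_Mapping.lookup (f k) \<mu>)"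
      using fin by (intro sum.mono_neutral_left) auto
    also have "\<dots> = (\<Sum>k\<in>{m}. Poly_Mapping.lookup (f k) \<mu>)"
      using fin zero by (intro sum.mono_neutral_right) auto
    finally show ?thesis by simp
  qed
  have "inj_on Sum_any (finsupp_families ?S)"
  proof (intro inj_onI ext poly_mapping_eqI)
    fix f g m \<mu> assume fg: "f \<in> finsupp_families ?S" "g \<in> finsupp_families ?S"
      and eq: "Sum_any f = Sum_any g"
    show "Poly_Mapping.lookup (f m) \<mu> = Poly_Mapping.lookup (g m) \<mu>"
    proof (cases "weighted_degree v \<mu> = d * m")
      case True
      then show ?thesis using lookup fg eq by metis
    next
      case False
      have "f m \<in> ?S m" "g m \<in> ?S m" using fg by (auto simp: finsupp_families_def)
      then have "\<mu> \<notin> Poly_Mapping.keys (f m)" "\<mu> \<notin> Poly_Mapping.keys (g m)"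
        using False by (auto simp: veronese_def homogeneous_component_def)
      then show ?thesis by (simp add: in_keys_iff)
    qed
  qed
  then show ?thesis
    unfolding is_internal_direct_sum_def bij_betw_def graded_carrier_def by blast
qed

text \<open>Iterating \<open>split\<close> factors each monomial of degree \<open>d * m\<close> into
  \<open>m\<close> monomials of degree \<open>d\<close>. The powers of the first component are then
  the Veronese components themselves, whose sum is already known to be direct.\<close>

lemma generated_in_degree_one_veronese:
  fixes T :: "(nat \<Rightarrow>\<^sub>0 nat) set"
  assumes d: "d > 0" and T: "add_closed T"
    and split: "\<And>\<mu> m. \<mu> \<in> T \<Longrightarrow> m \<ge> 1 \<Longrightarrow> weighted_degree v \<mu> = d * Suc m \<Longrightarrow>
      \<exists>\<nu>\<in>T. \<exists>\<nu>'\<in>T. \<mu> = \<nu> + \<nu>' \<and> weighted_degree v \<nu> = d \<and> weighted_degree v \<nu>' = d * m"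
  shows "generated_in_degree_one
    (veronese d (homogeneous_component v (supported_on T :: 'a::comm_ring_1 mpoly set)))"
proof -
  let ?S = "veronese d (homogeneous_component v (supported_on T :: 'a mpoly set))"
  have A: "subalgebra (supported_on T :: 'a mpoly set)" by (rule subalgebra_supported_on[OF T])
  have monomial: "\<exists>as. length as = Suc m \<and> set as \<subseteq> ?S 1 \<and> prod_list as = Poly_Mapping.single \<mu> c"
    if "\<mu> \<in> T" "weighted_degree v \<mu> = d * Suc m" for \<mu> m c
    using that
  proof (induction m arbitrary: \<mu> c)
    case 0
    then have "Poly_Mapping.single \<mu> c \<in> ?S 1"
      by (auto simp: veronese_def homogeneous_component_def supported_on_def)
    \<comment> \<open>The last factor carries the coefficient \<open>c\<close>; all factors put in
      front of it have coefficient 1.\<close>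
    then show ?case by (intro exI[of _ "[Poly_Mapping.single \<mu> c]"]) auto
  next
    case (Suc m)
    then obtain \<nu> \<nu>' where \<nu>: "\<nu> \<in> T" "\<nu>' \<in> T" "\<mu> = \<nu> + \<nu>'" "weighted_degree v \<nu> = d"
        "weighted_degree v \<nu>' = d * Suc m"
      using split[of \<mu> "Suc m"] by auto
    then obtain as where as: "length as = Suc m" "set as \<subseteq> ?S 1" "prod_list as = Poly_Mapping.single \<nu>' c"
      using Suc.IH by blast
    have "Poly_Mapping.single \<nu> 1 \<in> ?S 1"
      using \<nu> by (auto simp: veronese_def homogeneous_component_def supported_on_def)
    then show ?case
      using as \<nu> by (intro exI[of _ "Poly_Mapping.single \<nu> 1 # as"]) (simp add: mult_single)
  qed
  have power: "power_subgroup (?S 1) m = ?S m" if "m \<noteq> 0" for m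
  proof
    show "power_subgroup (?S 1) m \<subseteq> ?S m"
      unfolding power_subgroup_def
    proof (rule hull_minimal)
      show "{prod_list as |as. length as = m \<and> set as \<subseteq> ?S 1} \<subseteq> ?S m"
        using prod_list_homogeneous_component[OF A, of _ v d] by (auto simp: veronese_def)
      show "additive_subgroup (?S m)"
        unfolding veronese_def
        by (intro additive_subgroup_homogeneous_component additive_subgroup_subalgebra A)
    qed
    show "?S m \<subseteq> power_subgroup (?S 1) m"
    proof
      fix p assume p: "p \<in> ?S m"
      show "p \<in> power_subgroup (?S 1) m"
        unfolding power_subgroup_def
      proof (rule mem_additive_subgroup_if_monomials[OF additive_subgroup_hull hull_inc])
        fix \<mu> assume "\<mu> \<in> Poly_Mapping.keys p"
        then have "\<mu> \<in> T" "weighted_degree v \<mu> = d * Suc (m - 1)"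
          using p that by (auto simp: veronese_def homogeneous_component_def supported_on_def)
        from monomial[OF this, of "Poly_Mapping.lookup p \<mu>"]
        show "Poly_Mapping.single \<mu> (Poly_Mapping.lookup p \<mu>)
          \<in> {prod_list as |as. length as = m \<and> set as \<subseteq> ?S 1}"
          using that by (auto intro: sym)
      qed
    qed
  qed
  have "(\<lambda>m. if m = 0 then ?S 0 else power_subgroup (?S 1) m) = ?S"
  proof
    show "(if m = 0 then ?S 0 else power_subgroup (?S 1) m) = ?S m" for m
      using power[of m] by (cases "m = 0") simp_all
  qed
  then show ?thesis
    unfolding generated_in_degree_one_def by (simp only: internal_direct_sum_veronese[OF d])
qed

section \<open>The polynomial ring and the Rees ring\<close>

lemma ex_poly_mapping_on:
  fixes b :: "'i \<Rightarrow> 'b::zero"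
  assumes "finite I"
  obtains \<nu> where "\<And>i. Poly_Mapping.lookup \<nu> i = (if i \<in> I then b i else 0)"
proof
  have "finite {i. (if i \<in> I then b i else 0) \<noteq> 0}"
    by (rule finite_subset[OF _ assms]) auto
  then show "Poly_Mapping.lookup (Abs_poly_mapping (\<lambda>i. if i \<in> I then b i else 0)) i = (if i \<in> I then b i else 0)" for i
    by simp
qed

lemma poly_mapping_le_obtain_diff:
  fixes \<mu> \<nu> :: "'i \<Rightarrow>\<^sub>0 nat"
  assumes "\<And>i. Poly_Mapping.lookup \<nu> i \<le> Poly_Mapping.lookup \<mu> i"
  obtains \<nu>' where "\<mu> = \<nu> + \<nu>'"
proof
  show "\<mu> = \<nu> + (\<mu> - \<nu>)"
    using assms by (intro poly_mapping_eqI) (simp add: lookup_add lookup_minus)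
qed

lemma keys_add_nat:
  fixes \<mu> \<nu> :: "'i \<Rightarrow>\<^sub>0 nat"
  shows "Poly_Mapping.keys (\<mu> + \<nu>) = Poly_Mapping.keys \<mu> \<union> Poly_Mapping.keys \<nu>"
  by (auto simp: in_keys_iff lookup_add)

lemma indet_power: "indet i ^ e = (Poly_Mapping.single (Poly_Mapping.single i e) 1 :: 'a::comm_ring_1 mpoly)"
  by (induction e) (simp_all add: indet_def mult_single flip: single_add)

text \<open>Ignores the exponent of t at index 0. It is the degree on exponents of P, a bound for
  the t-exponent on those of the Rees ring, and for constant weight 1 the termination measure for
  both ring descriptions.\<close>

definition x_weight :: "nat \<Rightarrow> (nat \<Rightarrow> nat) \<Rightarrow> (nat \<Rightarrow>\<^sub>0 nat) \<Rightarrow> nat" where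
  "x_weight n w \<mu> = (\<Sum>i\<in>{1..n}. w i * Poly_Mapping.lookup \<mu> i)"

lemma x_weight_add: "x_weight n w (\<mu> + \<nu>) = x_weight n w \<mu> + x_weight n w \<nu>"
  by (simp add: x_weight_def lookup_add distrib_left sum.distrib)

lemma x_weight_single: "x_weight n w (Poly_Mapping.single i e) = (if i \<in> {1..n} then w i * e else 0)"
proof -
  have "x_weight n w (Poly_Mapping.single i e) = (\<Sum>k\<in>{1..n}. if k = i then w i * e else 0)"
    unfolding x_weight_def by (intro sum.cong) (auto simp: lookup_single when_def)
  then show ?thesis by simp
qed

lemma weight_lcm_pos:
  assumes "\<And>i. i \<in> {1..n} \<Longrightarrow> 0 < w i"
  shows "weight_lcm n w > 0"
proof -
  have "weight_lcm n w \<noteq> 0"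
    unfolding weight_lcm_def using assms by (subst Lcm_0_iff) force+
  then show ?thesis by simp
qed

text \<open>\<open>ex_subvector_of_weight\<close> for exponent vectors. Keeping the keys in
  \<open>{1..n}\<close> leaves the t-exponent free to be chosen separately.\<close>

lemma ex_subexponent_of_x_weight:
  assumes w: "\<And>i. i \<in> {1..n} \<Longrightarrow> 0 < w i \<and> w i \<le> M"
    and large: "n \<le> 2 \<or> 2 * n * M\<^sup>2 \<le> weight_lcm n w"
    and \<mu>: "2 * weight_lcm n w \<le> x_weight n w \<mu>"
  shows "\<exists>\<nu>. (\<forall>i. Poly_Mapping.lookup \<nu> i \<le> Poly_Mapping.lookup \<mu> i) \<and>
    Poly_Mapping.keys \<nu> \<subseteq> {1..n} \<and> x_weight n w \<nu> = weight_lcm n w"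
proof -
  have pos: "weight_lcm n w > 0" using w by (intro weight_lcm_pos) simp
  have "\<exists>b. (\<forall>i\<in>{1..n}. b i \<le> Poly_Mapping.lookup \<mu> i) \<and> (\<Sum>i\<in>{1..n}. b i * w i) = weight_lcm n w"
    using large \<mu> pos
    by (intro ex_subvector_of_weight[where M = M] w)
      (auto simp: weight_lcm_def x_weight_def mult.commute)
  then obtain b where b: "\<And>i. i \<in> {1..n} \<Longrightarrow> b i \<le> Poly_Mapping.lookup \<mu> i"
      "(\<Sum>i\<in>{1..n}. b i * w i) = weight_lcm n w" by blast
  obtain \<nu> where \<nu>: "\<And>i. Poly_Mapping.lookup \<nu> i = (if i \<in> {1..n} then b i else 0)"
    using ex_poly_mapping_on[of "{1..n}" b] by blast
  have "x_weight n w \<nu> = weight_lcm n w"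
    unfolding b(2)[symmetric] x_weight_def by (intro sum.cong) (auto simp: \<nu> mult.commute)
  then show ?thesis using b(1) \<nu> by (intro exI[of _ \<nu>]) (auto simp: in_keys_iff split: if_splits)
qed

section \<open>The two rings as monoid algebras\<close>

definition P_exponents :: "nat \<Rightarrow> (nat \<Rightarrow>\<^sub>0 nat) set" where
  "P_exponents n = {\<mu>. Poly_Mapping.keys \<mu> \<subseteq> {1..n}}"

definition R_exponents :: "nat \<Rightarrow> (nat \<Rightarrow> nat) \<Rightarrow> (nat \<Rightarrow>\<^sub>0 nat) set" where
  "R_exponents n w = {\<mu>. Poly_Mapping.keys \<mu> \<subseteq> {0..n} \<and> Poly_Mapping.lookup \<mu> 0 \<le> x_weight n w \<mu>}"

lemma add_closed_P_exponents: "add_closed (P_exponents n)"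
  by (auto simp: add_closed_def P_exponents_def keys_add_nat)

lemma add_closed_R_exponents: "add_closed (R_exponents n w)"
  by (auto simp: add_closed_def R_exponents_def keys_add_nat x_weight_add lookup_add add_mono)

lemma polynomial_ring_eq: "polynomial_ring n = (supported_on (P_exponents n) :: 'a::comm_ring_1 mpoly set)"
  unfolding polynomial_ring_def
proof (rule subalgebra_hull_eq_supported_on[OF add_closed_P_exponents, where f = "x_weight n (\<lambda>_. 1)"])
  show "{indet i |i. i \<in> {1..n}} \<subseteq> (supported_on (P_exponents n) :: 'a mpoly set)"
    by (auto simp: supported_on_def P_exponents_def indet_def)
  fix \<mu> assume \<mu>: "\<mu> \<in> P_exponents n" "\<mu> \<noteq> 0"
  then obtain i where i: "i \<in> Poly_Mapping.keys \<mu>" by (metis all_not_in_conv keys_eq_empty)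
  then have i_n: "i \<in> {1..n}" using \<mu> by (auto simp: P_exponents_def)
  have "Poly_Mapping.lookup (Poly_Mapping.single i 1) k \<le> Poly_Mapping.lookup \<mu> k" for k
    using i by (auto simp: lookup_single when_def in_keys_iff)
  then obtain \<mu>' where eq: "\<mu> = Poly_Mapping.single i 1 + \<mu>'" by (rule poly_mapping_le_obtain_diff)
  have "Poly_Mapping.single (Poly_Mapping.single i 1) 1 \<in> ({indet i |i. i \<in> {1..n}} :: 'a mpoly set)"
    using i_n by (auto simp: indet_def)
  moreover have "\<mu>' \<in> P_exponents n" using \<mu>(1) by (simp add: eq P_exponents_def keys_add_nat)
  moreover have "x_weight n (\<lambda>_. 1) \<mu>' < x_weight n (\<lambda>_. 1) \<mu>"
    using i_n unfolding eq x_weight_add x_weight_single by simp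
  ultimately show "\<exists>\<gamma> \<mu>'. \<mu> = \<gamma> + \<mu>' \<and>
      Poly_Mapping.single \<gamma> 1 \<in> ({indet i |i. i \<in> {1..n}} :: 'a mpoly set) \<and>
      \<mu>' \<in> P_exponents n \<and> x_weight n (\<lambda>_. 1) \<mu>' < x_weight n (\<lambda>_. 1) \<mu>"
    using eq by blast
qed

text \<open>Each factor \<open>x_i\<close> brings at most \<open>w i\<close> factors t, which bounds
  the t-exponent by the x-weight. Conversely, peel off one \<open>x_i\<close> together with as many
  factors t as it may carry.\<close>

lemma rees_ring_eq: "rees_ring n w = (supported_on (R_exponents n w) :: 'a::comm_ring_1 mpoly set)"
proof -
  let ?G = "{indet_t ^ d * indet i |i d. i \<in> {1..n} \<and> d \<in> {0..w i}} :: 'a mpoly set"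
  have gen: "indet_t ^ d * indet i
      = (Poly_Mapping.single (Poly_Mapping.single 0 d + Poly_Mapping.single i 1) 1 :: 'a mpoly)" for i d
    unfolding indet_power by (simp add: indet_def mult_single)
  show ?thesis
    unfolding rees_ring_def
  proof (rule subalgebra_hull_eq_supported_on[OF add_closed_R_exponents, where f = "x_weight n (\<lambda>_. 1)"])
    show "?G \<subseteq> supported_on (R_exponents n w)"
      by (auto simp: supported_on_def R_exponents_def gen keys_add_nat x_weight_add x_weight_single
          lookup_add lookup_single split: if_splits)
    fix \<mu> assume \<mu>: "\<mu> \<in> R_exponents n w" "\<mu> \<noteq> 0"
    \<comment> \<open>Without any \<open>x_i\<close> the x-weight is 0, which excludes t as well and
      forces \<open>\<mu> = 0\<close>.\<close>
    have "\<exists>i\<in>{1..n}. Poly_Mapping.lookup \<mu> i \<noteq> 0"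
    proof (rule ccontr)
      assume none: "\<not> ?thesis"
      then have "x_weight n w \<mu> = 0" by (simp add: x_weight_def)
      then have 0: "Poly_Mapping.lookup \<mu> 0 = 0" using \<mu>(1) by (simp add: R_exponents_def)
      have "Poly_Mapping.lookup \<mu> k = 0" for k
      proof (cases "k \<in> {0..n}")
        case True
        then show ?thesis using none 0 by (cases "k = 0") auto
      next
        case False
        then show ?thesis using \<mu>(1) by (auto simp: R_exponents_def in_keys_iff)
      qed
      then show False using \<mu>(2) by (auto intro: poly_mapping_eqI)
    qed
    then obtain i where i: "i \<in> {1..n}" "Poly_Mapping.lookup \<mu> i \<noteq> 0" by blast
    \<comment> \<open>If \<open>e = w i\<close>, both sides of the inequality defining
      \<open>R_exponents\<close> drop by \<open>w i\<close>; otherwise no t is left in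
      \<open>\<mu>'\<close> and the inequality is trivial.\<close>
    define e where "e = min (Poly_Mapping.lookup \<mu> 0) (w i)"
    let ?\<gamma> = "Poly_Mapping.single 0 e + Poly_Mapping.single i 1"
    have "Poly_Mapping.lookup ?\<gamma> k \<le> Poly_Mapping.lookup \<mu> k" for k
      using i by (auto simp: lookup_add lookup_single when_def e_def)
    then obtain \<mu>' where eq: "\<mu> = ?\<gamma> + \<mu>'" by (rule poly_mapping_le_obtain_diff)
    have "e \<in> {0..w i}" by (simp add: e_def)
    then have "indet_t ^ e * indet i \<in> ?G" using i(1) by blast
    then have "Poly_Mapping.single ?\<gamma> 1 \<in> ?G" by (simp only: gen[of e i])
    moreover have "\<mu>' \<in> R_exponents n w"
    proof -
      have "Poly_Mapping.lookup \<mu> 0 = e + Poly_Mapping.lookup \<mu>' 0"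
        using i unfolding eq by (simp add: lookup_add lookup_single)
      moreover have "x_weight n w \<mu> = w i + x_weight n w \<mu>'"
        using i unfolding eq by (simp add: x_weight_add x_weight_single)
      ultimately have "Poly_Mapping.lookup \<mu>' 0 \<le> x_weight n w \<mu>'"
        using \<mu>(1) unfolding R_exponents_def e_def by (auto simp: min_def split: if_splits)
      moreover have "Poly_Mapping.keys \<mu>' \<subseteq> {0..n}"
        using \<mu>(1) by (simp add: eq R_exponents_def keys_add_nat)
      ultimately show ?thesis by (simp add: R_exponents_def)
    qed
    moreover have "x_weight n (\<lambda>_. 1) \<mu>' < x_weight n (\<lambda>_. 1) \<mu>"
      using i unfolding eq x_weight_add x_weight_single by simp
    ultimately show "\<exists>\<gamma> \<mu>'. \<mu> = \<gamma> + \<mu>' \<and> Poly_Mapping.single \<gamma> 1 \<in> ?G \<and>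
        \<mu>' \<in> R_exponents n w \<and> x_weight n (\<lambda>_. 1) \<mu>' < x_weight n (\<lambda>_. 1) \<mu>"
      using eq by blast
  qed
qed

lemma weighted_degree_P_exponents: "\<mu> \<in> P_exponents n \<Longrightarrow> weighted_degree w \<mu> = x_weight n w \<mu>"
  by (simp add: P_exponents_def x_weight_def weighted_degree_eq_sum)

lemma weighted_degree_t: "weighted_degree (\<lambda>i. if i = 0 then 1 else 0) \<mu> = Poly_Mapping.lookup \<mu> 0"
proof -
  let ?I = "insert 0 (Poly_Mapping.keys \<mu>)"
  have "weighted_degree (\<lambda>i. if i = 0 then 1 else 0) \<mu> = (\<Sum>i\<in>?I. (if i = 0 then 1 else 0) * Poly_Mapping.lookup \<mu> i)"
    by (rule weighted_degree_eq_sum) auto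
  also have "\<dots> = (\<Sum>i\<in>?I. if i = 0 then Poly_Mapping.lookup \<mu> 0 else 0)"
    by (rule sum.cong) auto
  also have "\<dots> = Poly_Mapping.lookup \<mu> 0" by (subst sum.delta) auto
  finally show ?thesis .
qed

text \<open>For P the x-weight is the degree, so the subvector of weight \<open>d\<close> is the
  required factor. For the Rees ring the t-degree bounds the x-weight from below, so such a
  subvector exists there too and is multiplied by \<open>t^d\<close>.\<close>

lemma generated_in_degree_one_of_large_weight_lcm:
  assumes w: "\<And>i. i \<in> {1..n} \<Longrightarrow> 0 < w i \<and> w i \<le> M"
    and large: "n \<le> 2 \<or> 2 * n * M\<^sup>2 \<le> weight_lcm n w"
  shows "generated_in_degree_one
      (veronese (weight_lcm n w) (graded_P n w :: nat \<Rightarrow> 'a::comm_ring_1 mpoly set))"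
    and "generated_in_degree_one
      (veronese (weight_lcm n w) (graded_R n w :: nat \<Rightarrow> 'a::comm_ring_1 mpoly set))"
proof -
  let ?d = "weight_lcm n w" and ?t = "\<lambda>i::nat. if i = 0 then 1 else 0 :: nat"
  have d: "?d > 0" using w by (intro weight_lcm_pos) simp
  show "generated_in_degree_one (veronese ?d (graded_P n w :: nat \<Rightarrow> 'a mpoly set))"
    unfolding graded_P_def polynomial_ring_eq
  proof (rule generated_in_degree_one_veronese[OF d add_closed_P_exponents])
    fix \<mu> m assume \<mu>: "\<mu> \<in> P_exponents n" "m \<ge> 1" "weighted_degree w \<mu> = ?d * Suc m"
    then have W: "x_weight n w \<mu> = ?d + ?d * m" by (simp add: weighted_degree_P_exponents)
    moreover have "?d * 1 \<le> ?d * m" using \<mu>(2) by (intro mult_left_mono) auto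
    ultimately have "2 * ?d \<le> x_weight n w \<mu>" by linarith
    from ex_subexponent_of_x_weight[OF w large this]
    obtain \<nu> where \<nu>: "\<And>i. Poly_Mapping.lookup \<nu> i \<le> Poly_Mapping.lookup \<mu> i"
      "Poly_Mapping.keys \<nu> \<subseteq> {1..n}" "x_weight n w \<nu> = ?d" by blast
    obtain \<nu>' where eq: "\<mu> = \<nu> + \<nu>'" using \<nu>(1) by (rule poly_mapping_le_obtain_diff)
    have "\<nu> \<in> P_exponents n" "\<nu>' \<in> P_exponents n"
      using \<mu>(1) by (simp_all add: eq P_exponents_def keys_add_nat)
    moreover have "x_weight n w \<nu>' = ?d * m" using W \<nu>(3) unfolding eq x_weight_add by simp
    ultimately show "\<exists>\<nu>\<in>P_exponents n. \<exists>\<nu>'\<in>P_exponents n.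
        \<mu> = \<nu> + \<nu>' \<and> weighted_degree w \<nu> = ?d \<and> weighted_degree w \<nu>' = ?d * m"
      using eq \<nu>(3) weighted_degree_P_exponents by metis
  qed
  show "generated_in_degree_one (veronese ?d (graded_R n w :: nat \<Rightarrow> 'a mpoly set))"
    unfolding graded_R_def rees_ring_eq
  proof (rule generated_in_degree_one_veronese[OF d add_closed_R_exponents])
    fix \<mu> m assume \<mu>: "\<mu> \<in> R_exponents n w" "m \<ge> 1" "weighted_degree ?t \<mu> = ?d * Suc m"
    then have t: "Poly_Mapping.lookup \<mu> 0 = ?d + ?d * m" by (simp add: weighted_degree_t)
    then have W: "?d + ?d * m \<le> x_weight n w \<mu>" using \<mu>(1) by (simp add: R_exponents_def)
    moreover have "?d * 1 \<le> ?d * m" using \<mu>(2) by (intro mult_left_mono) auto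
    ultimately have "2 * ?d \<le> x_weight n w \<mu>" by linarith
    from ex_subexponent_of_x_weight[OF w large this]
    obtain \<beta> where \<beta>: "\<And>i. Poly_Mapping.lookup \<beta> i \<le> Poly_Mapping.lookup \<mu> i"
      "Poly_Mapping.keys \<beta> \<subseteq> {1..n}" "x_weight n w \<beta> = ?d" by blast
    \<comment> \<open>The t-exponent of \<open>\<nu>\<close> equals its x-weight. Removing
      \<open>\<nu>\<close> thus lowers both sides of the Rees inequality by the same amount, and the
      cofactor stays in \<open>R_exponents\<close>.\<close>
    define \<nu> where "\<nu> = Poly_Mapping.single 0 ?d + \<beta>"
    have \<beta>0: "Poly_Mapping.lookup \<beta> 0 = 0" using \<beta>(2) by (auto simp: in_keys_iff)
    have \<nu>0: "Poly_Mapping.lookup \<nu> 0 = ?d" by (simp add: \<nu>_def lookup_add \<beta>0)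
    have W\<nu>: "x_weight n w \<nu> = ?d" by (simp add: \<nu>_def x_weight_add x_weight_single \<beta>(3))
    have "Poly_Mapping.lookup \<nu> i \<le> Poly_Mapping.lookup \<mu> i" for i
      using \<beta>(1)[of i] \<beta>0 t by (cases "i = 0") (simp_all add: \<nu>_def lookup_add lookup_single)
    then obtain \<nu>' where eq: "\<mu> = \<nu> + \<nu>'" by (rule poly_mapping_le_obtain_diff)
    have \<nu>'0: "Poly_Mapping.lookup \<nu>' 0 = ?d * m" using t \<nu>0 unfolding eq lookup_add by simp
    have "?d * m \<le> x_weight n w \<nu>'" using W W\<nu> unfolding eq x_weight_add by simp
    then have "\<nu> \<in> R_exponents n w" "\<nu>' \<in> R_exponents n w"
      using \<mu>(1) \<nu>0 \<nu>'0 W\<nu> by (simp_all add: eq R_exponents_def keys_add_nat)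
    then show "\<exists>\<nu>\<in>R_exponents n w. \<exists>\<nu>'\<in>R_exponents n w.
        \<mu> = \<nu> + \<nu>' \<and> weighted_degree ?t \<nu> = ?d \<and> weighted_degree ?t \<nu>' = ?d * m"
      unfolding weighted_degree_t using eq \<nu>0 \<nu>'0 by blast
  qed
qed

section \<open>Weight vectors with small least common multiple are rare\<close>

text \<open>Apply \<open>x * y = gcd x y * lcm x y\<close> twice and bound
  \<open>gcd (lcm a b) c\<close> by \<open>gcd a c * gcd b c\<close>.\<close>

lemma triple_prod_le_Lcm_mult_gcds:
  fixes a b c :: nat
  shows "a * b * c \<le> lcm (lcm a b) c * (gcd a b * gcd c a * gcd b c)"
proof (cases "a = 0 \<or> b = 0 \<or> c = 0")
  case False
  have "gcd (lcm a b) c dvd gcd (a * b) c"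
    by (meson dvd_triv_left dvd_triv_right gcd_mono dvd_refl lcm_least)
  also have "gcd (a * b) c dvd gcd a c * gcd b c"
  proof -
    \<comment> \<open>A divisor of \<open>a * b\<close> splits into a divisor of \<open>a\<close>
      and one of \<open>b\<close>; here both also divide \<open>c\<close>.\<close>
    obtain x y where xy: "gcd (a * b) c = x * y" "x dvd a" "y dvd b"
      using division_decomp[of "gcd (a * b) c" a b] by blast
    have "x dvd c" "y dvd c" using xy(1) by (metis dvd_mult_left dvd_mult_right gcd_dvd2)+
    then show ?thesis using xy by (simp add: mult_dvd_mono)
  qed
  finally have le: "gcd (lcm a b) c \<le> gcd a c * gcd b c"
    using False by (intro dvd_imp_le) auto
  have "a * b * c = gcd a b * (lcm a b * c)" by (simp only: prod_gcd_lcm_nat[of a b] mult.assoc)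
  also have "lcm a b * c = lcm (lcm a b) c * gcd (lcm a b) c"
    by (metis prod_gcd_lcm_nat mult.commute)
  also have "gcd a b * \<dots> \<le> gcd a b * (lcm (lcm a b) c * (gcd a c * gcd b c))"
    using le by (intro mult_left_mono) auto
  finally show ?thesis by (simp add: ac_simps gcd.commute)
qed auto

text \<open>Telescoping with \<open>1 / (m + 1)^2 \<le> 1 / m - 1 / (m + 1)\<close>, starting from
  the empty sum at \<open>M = G\<close>.\<close>

lemma sum_inverse_squares_tail:
  fixes G M :: nat
  assumes "G > 0"
  shows "(\<Sum>g\<in>{G<..M}. 1 / real g ^ 2) \<le> 1 / real G"
proof -
  have "(\<Sum>g\<in>{G<..M}. 1 / real g ^ 2) \<le> 1 / real G - 1 / real M" if "G \<le> M"
    using that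
  proof (induction M rule: dec_induct)
    case (step m)
    have m: "m > 0" using step assms by linarith
    have "{G<..Suc m} = insert (Suc m) {G<..m}" using step by auto
    then have "(\<Sum>g\<in>{G<..Suc m}. 1 / real g ^ 2) = 1 / real (Suc m) ^ 2 + (\<Sum>g\<in>{G<..m}. 1 / real g ^ 2)"
      by simp
    also have "\<dots> \<le> 1 / real (Suc m) ^ 2 + (1 / real G - 1 / real m)" using step by simp
    also have "1 / real (Suc m) ^ 2 \<le> 1 / real m - 1 / real (Suc m)"
    proof -
      have "1 / real (Suc m) ^ 2 \<le> 1 / (real m * real (Suc m))"
        using m unfolding power2_eq_square by (intro divide_left_mono mult_right_mono) auto
      also have "\<dots> = 1 / real m - 1 / real (Suc m)"
        using m by (simp add: field_simps)
      finally show ?thesis .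
    qed
    finally show ?case by simp
  qed simp
  moreover have "0 \<le> 1 / real M" by simp
  ultimately show ?thesis by (cases "G \<le> M") (auto intro: order_trans)
qed

text \<open>The exceptional pairs. Size is tested on the first entry only: in the cyclic pairs
  (1,2), (2,3), (3,1) each of three weights comes first once.\<close>

definition sparse_pairs :: "nat \<Rightarrow> nat \<Rightarrow> (nat \<times> nat) set" where
  "sparse_pairs G M = {(x, y) \<in> {1..M} \<times> {1..M}. G * x \<le> M \<or> G < gcd x y}"

lemma card_multiples_atMost:
  fixes g M :: nat
  assumes "g > 0"
  shows "card {x \<in> {1..M}. g dvd x} \<le> M div g"
proof -
  have "{x \<in> {1..M}. g dvd x} \<subseteq> (\<lambda>k. g * k) ` {1..M div g}"
  proof
    fix x assume "x \<in> {x \<in> {1..M}. g dvd x}"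
    then obtain k where "x = g * k" "1 \<le> x" "x \<le> M" by auto
    moreover from this assms have "k \<le> M div g"
      by (simp add: less_eq_div_iff_mult_less_eq mult.commute)
    ultimately show "x \<in> (\<lambda>k. g * k) ` {1..M div g}" by (cases "k = 0") auto
  qed
  then have "card {x \<in> {1..M}. g dvd x} \<le> card ((\<lambda>k. g * k) ` {1..M div g})"
    by (intro card_mono) auto
  also have "\<dots> \<le> M div g" using card_image_le[of "{1..M div g}"] by force
  finally show ?thesis .
qed

text \<open>Small first entries give at most \<open>M\<^sup>2 / G\<close> pairs. Pairs with gcd
  \<open>g\<close> consist of two multiples of \<open>g\<close>, at most
  \<open>(M / g)\<^sup>2\<close> pairs, and summing over \<open>g > G\<close> again gives at most
  \<open>M\<^sup>2 / G\<close>.\<close>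

lemma card_sparse_pairs_le:
  assumes "G > 0"
  shows "real (card (sparse_pairs G M)) \<le> 2 * real M ^ 2 / real G"
proof -
  let ?D = "\<lambda>g. {x \<in> {1..M}. g dvd x}"
  have sub: "sparse_pairs G M \<subseteq> {1..M div G} \<times> {1..M} \<union> (\<Union>g\<in>{G<..M}. ?D g \<times> ?D g)"
  proof (rule subsetI)
    fix z assume "z \<in> sparse_pairs G M"
    then obtain x y where z: "z = (x, y)" and xy: "x \<in> {1..M}" "y \<in> {1..M}"
      and alt: "G * x \<le> M \<or> G < gcd x y" by (auto simp: sparse_pairs_def)
    show "z \<in> {1..M div G} \<times> {1..M} \<union> (\<Union>g\<in>{G<..M}. ?D g \<times> ?D g)"
    proof (cases "G * x \<le> M")
      case True
      then have "x \<le> M div G" using assms by (simp add: less_eq_div_iff_mult_less_eq mult.commute)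
      then show ?thesis using xy z by auto
    next
      case False
      then have "G < gcd x y" using alt by blast
      moreover have "gcd x y \<le> x" using xy by (intro gcd_le1_nat) auto
      ultimately have "gcd x y \<in> {G<..M}" "x \<in> ?D (gcd x y)" "y \<in> ?D (gcd x y)"
        using xy by auto
      then show ?thesis using z by blast
    qed
  qed
  have "card (sparse_pairs G M) \<le> card ({1..M div G} \<times> {1..M} \<union> (\<Union>g\<in>{G<..M}. ?D g \<times> ?D g))"
    by (rule card_mono[OF _ sub]) auto
  also have "\<dots> \<le> card ({1..M div G} \<times> {1..M}) + card (\<Union>g\<in>{G<..M}. ?D g \<times> ?D g)"
    by (rule card_Un_le)
  also have "card (\<Union>g\<in>{G<..M}. ?D g \<times> ?D g) \<le> (\<Sum>g\<in>{G<..M}. card (?D g \<times> ?D g))"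
    by (rule card_UN_le) simp
  finally have "card (sparse_pairs G M) \<le> (M div G) * M + (\<Sum>g\<in>{G<..M}. card (?D g) * card (?D g))"
    by (simp add: card_cartesian_product)
  then have "real (card (sparse_pairs G M)) \<le> real ((M div G) * M + (\<Sum>g\<in>{G<..M}. card (?D g) * card (?D g)))"
    by (rule of_nat_mono)
  also have "\<dots> = real (M div G) * real M + (\<Sum>g\<in>{G<..M}. real (card (?D g)) * real (card (?D g)))"
    by simp
  also have "\<dots> \<le> real M / real G * real M + (\<Sum>g\<in>{G<..M}. (real M / real g) * (real M / real g))"
  proof (intro add_mono mult_right_mono sum_mono mult_mono)
    fix g assume "g \<in> {G<..M}"
    then have "card (?D g) \<le> M div g" using card_multiples_atMost by simp
    then have "real (card (?D g)) \<le> real (M div g)" by simp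
    then show "real (card (?D g)) \<le> real M / real g" using of_nat_div_le_of_nat[of M g] 
      by (meson order_trans)
    then show "real (card (?D g)) \<le> real M / real g" .
  qed (use of_nat_div_le_of_nat[of M G] in auto)
  also have "(\<Sum>g\<in>{G<..M}. (real M / real g) * (real M / real g)) = real M ^ 2 * (\<Sum>g\<in>{G<..M}. 1 / real g ^ 2)"
    by (simp add: sum_distrib_left power2_eq_square)
  also have "\<dots> \<le> real M ^ 2 * (1 / real G)"
    using sum_inverse_squares_tail[OF assms] by (intro mult_left_mono) auto
  finally show ?thesis by (simp add: power2_eq_square)
qed

text \<open>A vector is determined by its entries at \<open>i\<close>, \<open>j\<close> and its
  restriction to the other coordinates.\<close>

lemma card_PiE_pair_le:
  assumes fin: "finite I" "finite X" and ij: "i \<in> I" "j \<in> I" "i \<noteq> j" and R: "finite R"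
  shows "card {w \<in> I \<rightarrow>\<^sub>E X. (w i, w j) \<in> R} \<le> card R * card X ^ (card I - 2)"
proof -
  let ?h = "\<lambda>w. ((w i, w j), restrict w (I - {i, j}))"
  have "inj_on ?h {w \<in> I \<rightarrow>\<^sub>E X. (w i, w j) \<in> R}"
  proof (rule inj_onI)
    fix v w assume v: "v \<in> {w \<in> I \<rightarrow>\<^sub>E X. (w i, w j) \<in> R}" and w: "w \<in> {w \<in> I \<rightarrow>\<^sub>E X. (w i, w j) \<in> R}"
      and eq: "?h v = ?h w"
    have "v k = w k" if "k \<in> I" for k
    proof (cases "k = i \<or> k = j")
      case False
      have "restrict v (I - {i, j}) k = restrict w (I - {i, j}) k" using eq by simp
      then show ?thesis using False that by simp
    qed (use eq in auto)
    then show "v = w" using v w by (auto intro: PiE_ext)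
  qed
  moreover have "?h ` {w \<in> I \<rightarrow>\<^sub>E X. (w i, w j) \<in> R} \<subseteq> R \<times> ((I - {i, j}) \<rightarrow>\<^sub>E X)"
    by (auto simp: PiE_iff split: if_splits)
  ultimately have "card {w \<in> I \<rightarrow>\<^sub>E X. (w i, w j) \<in> R} \<le> card (R \<times> ((I - {i, j}) \<rightarrow>\<^sub>E X))"
    using fin R by (intro card_inj_on_le) (auto intro: finite_PiE)
  also have "\<dots> = card R * card X ^ (card I - 2)"
    using fin ij by (simp add: card_PiE card_Diff_subset card_cartesian_product numeral_2_eq_2)
  finally show ?thesis .
qed

text \<open>A small lcm forces one of three cyclic pairs of weights to be sparse, and each of these
  events has proportion at most \<open>2 / G\<close>.\<close>

lemma card_small_weight_lcm_le:
  assumes n: "n \<ge> 3" and G: "G > 0" and M: "K * G ^ 6 \<le> M"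
  shows "real (card {w \<in> {1..n} \<rightarrow>\<^sub>E {1..M}. weight_lcm n w < K * M\<^sup>2}) \<le> 6 / real G * real M ^ n"
proof -
  let ?B = "\<lambda>i j. {w \<in> {1..n} \<rightarrow>\<^sub>E {1..M}. (w i, w j) \<in> sparse_pairs G M}"
  have fin: "finite ({1..n} \<rightarrow>\<^sub>E {1..M})" by (intro finite_PiE) auto
  have sub: "{w \<in> {1..n} \<rightarrow>\<^sub>E {1..M}. weight_lcm n w < K * M\<^sup>2} \<subseteq> ?B 1 2 \<union> (?B 2 3 \<union> ?B 3 1)"
  proof (rule subsetI, rule ccontr)
    fix w assume w: "w \<in> {w \<in> {1..n} \<rightarrow>\<^sub>E {1..M}. weight_lcm n w < K * M\<^sup>2}"
      and nB: "w \<notin> ?B 1 2 \<union> (?B 2 3 \<union> ?B 3 1)"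
    define a b c where "a = w 1" and "b = w 2" and "c = w 3"
    have mem: "a \<in> {1..M}" "b \<in> {1..M}" "c \<in> {1..M}" using w n by (auto simp: a_def b_def c_def)
    have "(a, b) \<notin> sparse_pairs G M" "(b, c) \<notin> sparse_pairs G M" "(c, a) \<notin> sparse_pairs G M"
      using w nB by (auto simp: a_def b_def c_def)
    then have big: "M < G * a" "M < G * b" "M < G * c"
      and gcds: "gcd a b \<le> G" "gcd b c \<le> G" "gcd c a \<le> G"
      using mem by (auto simp: sparse_pairs_def)
    have "w ` {1..n} \<subseteq> {1..M}" using w by auto
    then have "weight_lcm n w \<noteq> 0" unfolding weight_lcm_def
      by (subst Lcm_0_iff) auto
    moreover have "lcm (lcm a b) c dvd weight_lcm n w"
      unfolding weight_lcm_def a_def b_def c_def using n by (intro lcm_least dvd_Lcm) auto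
    ultimately have le: "lcm (lcm a b) c \<le> weight_lcm n w" by (intro dvd_imp_le) auto
    \<comment> \<open>Of the six factors \<open>G\<close> that arise, three come from the sizes
      \<open>M < G * a\<close> etc. and three from the pairwise gcds.\<close>
    have "M * M * M < G * a * (G * b) * (G * c)" 
      using big mem G by (intro mult_strict_mono) auto
    also have "\<dots> = G ^ 3 * (a * b * c)" by (simp add: power3_eq_cube)
    also have "\<dots> \<le> G ^ 3 * (lcm (lcm a b) c * (gcd a b * gcd c a * gcd b c))"
      by (intro mult_left_mono triple_prod_le_Lcm_mult_gcds) auto
    also have "\<dots> \<le> G ^ 3 * (weight_lcm n w * (G * G * G))"
      using le gcds by (intro mult_left_mono mult_mono) auto
    also have "\<dots> = G ^ 6 * weight_lcm n w" by (simp add: power_numeral_reduce)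
    also have "\<dots> \<le> G ^ 6 * (K * M\<^sup>2)" using w by (intro mult_left_mono) auto
    also have "\<dots> = (K * G ^ 6) * M\<^sup>2" by simp
    also have "\<dots> \<le> M * M\<^sup>2" using M by (intro mult_right_mono) auto
    finally show False by (simp add: power2_eq_square)
  qed
  have B: "real (card (?B i j)) \<le> 2 / real G * real M ^ n" if "i \<in> {1..n}" "j \<in> {1..n}" "i \<noteq> j" for i j
  proof -
    have "finite (sparse_pairs G M)" by (rule finite_subset[of _ "{1..M} \<times> {1..M}"]) (auto simp: sparse_pairs_def)
    then have "card (?B i j) \<le> card (sparse_pairs G M) * M ^ (n - 2)"
      using card_PiE_pair_le[of "{1..n}" "{1..M}" i j "sparse_pairs G M"] that by simp
    then have "real (card (?B i j)) \<le> real (card (sparse_pairs G M) * M ^ (n - 2))"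
      by (rule of_nat_mono)
    also have "\<dots> = real (card (sparse_pairs G M)) * real M ^ (n - 2)"
      by simp
    also have "\<dots> \<le> 2 * real M ^ 2 / real G * real M ^ (n - 2)"
      using card_sparse_pairs_le[OF G] by (intro mult_right_mono) auto
    also have "\<dots> = 2 / real G * real M ^ (2 + (n - 2))" by (simp only: power_add) simp
    also have "2 + (n - 2) = n" using n by simp
    finally show ?thesis .
  qed
  have "card {w \<in> {1..n} \<rightarrow>\<^sub>E {1..M}. weight_lcm n w < K * M\<^sup>2} \<le> card (?B 1 2 \<union> (?B 2 3 \<union> ?B 3 1))"
    by (rule card_mono[OF _ sub]) (use fin in auto)
  also have "\<dots> \<le> card (?B 1 2) + (card (?B 2 3) + card (?B 3 1))"
    by (meson add_left_mono card_Un_le order_trans)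
  finally have "real (card {w \<in> {1..n} \<rightarrow>\<^sub>E {1..M}. weight_lcm n w < K * M\<^sup>2})
      \<le> real (card (?B 1 2) + (card (?B 2 3) + card (?B 3 1)))"
    by (rule of_nat_mono)
  also have "\<dots> = real (card (?B 1 2)) + (real (card (?B 2 3)) + real (card (?B 3 1)))"
    by simp
  also have "\<dots> \<le> 2 / real G * real M ^ n + (2 / real G * real M ^ n + 2 / real G * real M ^ n)"
    using n by (intro add_mono B) auto
  also have "\<dots> = 6 / real G * real M ^ n" by simp
  finally show ?thesis .
qed

section \<open>Passage to the limit\<close>

lemma proportion_bounds:
  assumes n: "n \<ge> 1" and G: "G > 0" and M: "M > 0" "2 * n * G ^ 6 \<le> M"
  shows "proportion TYPE('a::comm_ring_1) n M \<le> 1" "1 - 6 / real G \<le> proportion TYPE('a) n M"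
proof -
  let ?X = "{1..n} \<rightarrow>\<^sub>E {1..M}" and ?good = "good_weights TYPE('a) n M"
  \<comment> \<open>The condition \<open>n \<ge> 3\<close> empties this set for
    \<open>n \<le> 2\<close>, where every weight vector is good.\<close>
  let ?small = "{w \<in> ?X. n \<ge> 3 \<and> weight_lcm n w < 2 * n * M\<^sup>2}"
  have fin: "finite ?X" by (intro finite_PiE) auto
  have cardX: "card ?X = M ^ n" by (simp add: card_PiE)
  have sub: "?good \<subseteq> ?X" by (auto simp: good_weights_def)
  have "card ?good \<le> M ^ n" using card_mono[OF fin sub] cardX by simp
  then have "real (card ?good) \<le> real M ^ n" by (metis of_nat_le_iff of_nat_power)
  then show "proportion TYPE('a) n M \<le> 1" using M by (simp add: proportion_def)
  have "?X \<subseteq> ?good \<union> ?small"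
  proof
    fix w assume w: "w \<in> ?X"
    show "w \<in> ?good \<union> ?small"
    proof (cases "w \<in> ?small")
      case False
      then have large: "n \<le> 2 \<or> 2 * n * M\<^sup>2 \<le> weight_lcm n w" using w by auto
      have "0 < w i \<and> w i \<le> M" if "i \<in> {1..n}" for i
        using PiE_mem[OF w that] by auto
      from generated_in_degree_one_of_large_weight_lcm[OF this large, where 'a = 'a] w
      show ?thesis by (simp add: good_weights_def)
    qed simp
  qed
  then have "card ?X \<le> card (?good \<union> ?small)"
    using fin sub by (intro card_mono) (auto intro: finite_subset)
  also have "\<dots> \<le> card ?good + card ?small" by (rule card_Un_le)
  finally have "real (M ^ n) \<le> real (card ?good + card ?small)" unfolding cardX by (rule of_nat_mono)
  moreover have "real (card ?small) \<le> 6 / real G * real M ^ n"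
  proof (cases "n \<ge> 3")
    case True
    then show ?thesis using card_small_weight_lcm_le[OF True G M(2)] by simp
  qed simp
  ultimately have "real M ^ n \<le> real (card ?good) + 6 / real G * real M ^ n" by simp
  then have "(1 - 6 / real G) * real M ^ n \<le> real (card ?good)" by (simp add: left_diff_distrib)
  then show "1 - 6 / real G \<le> proportion TYPE('a) n M"
    unfolding proportion_def using M by (subst pos_le_divide_eq) auto
qed

theorem theorem1p39:
  fixes n :: nat
  assumes "n \<ge> 1"
  shows "(\<lambda>M. proportion TYPE('a::comm_ring_1) n M) \<longlonglongrightarrow> 1"
proof (rule LIMSEQ_I)
  fix r :: real assume r: "0 < r"
  obtain G :: nat where G: "6 / r < real G" using reals_Archimedean2 by blast
  moreover have "0 < 6 / r" using r by simp
  ultimately have G_pos: "G > 0" by (metis gr0I less_asym of_nat_0)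
  have small: "6 / real G < r" using G G_pos r by (simp add: field_simps)
  \<comment> \<open>The bound \<open>2 * n * G ^ 6\<close> is \<open>K * G ^ 6\<close> with
    \<open>K = 2 * n\<close>; the \<open>Suc\<close> makes \<open>M > 0\<close> immediate.\<close>
  have "norm (proportion TYPE('a) n M - 1) < r" if "M \<ge> Suc (2 * n * G ^ 6)" for M
    using proportion_bounds[OF assms G_pos, of M, where 'a = 'a] that small by simp
  then show "\<exists>N. \<forall>M\<ge>N. norm (proportion TYPE('a) n M - 1) < r" by blast
qed

end
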